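(* Let $(S_\xi)_{\xi\in\Xi}$ be a nondegenerate family of balls in $\mathbb{R}^N$, and let $S\in\mathscr{V}_NS$, $S\neq\{0\}$. Then $S$ belongs to $\pi^{\uparrow}(\Xi)$ if and only if $$ S=\bigwedge_{(x_1,\dots,x_n)}\ \Bigl(\sum_{k=1}^{n}S(x_k)\Bigr)\bigvee_{\xi\in\Xi}\frac{S_\xi}{\sum_{k=1}^{n}S_\xi(x_k)}, $$ where the intersection ranges over all finite tuples $(x_1,\dots,x_n)$ ($n\ge 1$ arbitrary) of vectors of $\mathbb{R}^N$ that are not all zero.
   Context: $\mathscr{V}_N$ is the set of all nonempty compact convex subsets (convex figures) of $\mathbb{R}^N$. A figure $S$ is identified with its support function $S(z)=\sup\{(x,z): x\in S\}$, $z\in\mathbb{R}^N$, where $(\cdot,\cdot)$ is the standard inner product; thus $\mathscr{V}_N$ is a cone (with Minkowski addition and multiplication by nonnegative scalars $tS=\{ts:s\in S\}$) in the space $C(S_{N-1})$ of continuous functions on the Euclidean unit sphere $S_{N-1}$. The order $\le$ is inclusion; the join $\bigvee$ is the closed convex hull of the union (its support function is the pointwise supremum), and the meet $\bigwedge$ is intersection. Closedness refers to the Hausdorff metric, i.e. the Chebyshev norm of support functions on $S_{N-1}$. A ball is a symmetric ($S=-S$) absorbing member of $\mathscr{V}_N$. $\mathscr{V}_NS$ is the set of all balls in $\mathbb{R}^N$ together with $\{0\}$; its members are called gauges. For a ball $S$, $\|x\|_S=\inf\{\alpha>0: x/\alpha\in S\}$ for $x\in\mathbb{R}^N$, and $\|A\|_S=\sup\{\|Ax\|_S: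 x\in S\}$ for a linear endomorphism $A$ of $\mathbb{R}^N$. A family $(S_\xi)_{\xi\in\Xi}$ of balls (nonzero members of $\mathscr{V}_NS$) is nondegenerate if $\sup_{\xi\in\Xi}\|A\|_{S_\xi}<+\infty$ for every linear endomorphism $A$ of $\mathbb{R}^N$. For a nondegenerate family, the upper hull $\pi^{\uparrow}(\Xi)$ is the least closed cone that lies in $\mathscr{V}_NS$, contains $S_\xi$ for all $\xi\in\Xi$, and is closed under the binary join $\vee$ of $\mathscr{V}_N$. *)

theory Defs
  imports "HOL-Analysis.Analysis"
begin

definition convex_figures :: "(real^'n) set set" where
  "convex_figures = {S. S \<noteq> {} \<and> compact S \<and> convex S}"

definition supp_fun :: "(real^'n) set \<Rightarrow> real^'n \<Rightarrow> real" where
  "supp_fun S z = (SUP x\<in>S. x \<bullet> z)"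

definition dilate :: "real \<Rightarrow> (real^'n) set \<Rightarrow> (real^'n) set" where
  "dilate t S = (*\<^sub>R) t ` S"

definition join :: "(real^'n) set set \<Rightarrow> (real^'n) set" where
  "join \<S> = closure (convex hull (\<Union>\<S>))"

definition absorbing :: "(real^'n) set \<Rightarrow> bool" where
  "absorbing S \<longleftrightarrow> (\<forall>x. \<exists>a>0. \<forall>b. \<bar>b\<bar> \<ge> a \<longrightarrow> x \<in> dilate b S)"

definition sym_balls :: "(real^'n) set set" where
  "sym_balls = {S \<in> convex_figures. S = uminus ` S \<and> absorbing S}"

definition gauges :: "(real^'n) set set" where
  "gauges = insert {0} sym_balls"

definition gauge_norm :: "(real^'n) set \<Rightarrow> real^'n \<Rightarrow> real" where
  "gauge_norm S x = Inf {a. a > 0 \<and> x /\<^sub>R a \<in> S}"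

definition op_norm :: "(real^'n) set \<Rightarrow> (real^'n \<Rightarrow> real^'n) \<Rightarrow> real" where
  "op_norm S A = (SUP x\<in>S. gauge_norm S (A x))"

definition nondegenerate :: "'i set \<Rightarrow> ('i \<Rightarrow> (real^'n) set) \<Rightarrow> bool" where
  "nondegenerate \<Xi> F \<longleftrightarrow>
     (\<forall>\<xi>\<in>\<Xi>. F \<xi> \<in> sym_balls) \<and>
     (\<forall>A. linear A \<longrightarrow> bdd_above ((\<lambda>\<xi>. op_norm (F \<xi>) A) ` \<Xi>))"

text \<open>
  Convergence in the Hausdorff metric is convergence of support functions in the Chebyshev
  norm on the unit sphere, that is, their uniform convergence there; in a metric space,
  closedness is sequential closedness.
\<close>

definition closed_figures :: "(real^'n) set set \<Rightarrow> bool" where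
  "closed_figures K \<longleftrightarrow>
     (\<forall>F. \<forall>T\<in>convex_figures. (\<forall>n::nat. F n \<in> K) \<longrightarrow>
        uniform_limit (sphere 0 1) (\<lambda>n. supp_fun (F n)) (supp_fun T) sequentially \<longrightarrow> T \<in> K)"

text \<open>Addition of sets is Minkowski addition.\<close>

definition cone_of_figures :: "(real^'n) set set \<Rightarrow> bool" where
  "cone_of_figures K \<longleftrightarrow>
     K \<noteq> {} \<and> (\<forall>S\<in>K. \<forall>T\<in>K. S + T \<in> K) \<and> (\<forall>S\<in>K. \<forall>t\<ge>0. dilate t S \<in> K)"

text \<open>
  The set of all gauges is itself not closed (balls may flatten to a proper segment), so for an
  arbitrary family there need not be any closed cone to intersect. For a nondegenerate family
  there is one: the gauges \<open>S\<close> such that \<open>A ` S\<close> is contained in \<open>dilate (c A) S\<close> for all linear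
  \<open>A\<close>, where \<open>c A\<close> is a common nonnegative bound of the operator norms of \<open>A\<close>. Hence the
  intersection below is over a nonempty class, and it is the least member of that class.
\<close>

definition upper_hull :: "'i set \<Rightarrow> ('i \<Rightarrow> (real^'n) set) \<Rightarrow> (real^'n) set set" where
  "upper_hull \<Xi> F =
     (\<lambda>K. K \<subseteq> gauges \<and> cone_of_figures K \<and> closed_figures K \<and>
          (\<forall>S\<in>K. \<forall>T\<in>K. join {S, T} \<in> K)) hull (F ` \<Xi>)"

end

theory Submission
  imports Defs
begin

text \<open>
  Both conditions are equivalent to a third one: every inequality
  \<open>S\<^sub>\<xi>(z) \<le> S\<^sub>\<xi>(x\<^sub>1) + \<dots> + S\<^sub>\<xi>(x\<^sub>n)\<close> that holds for all \<open>\<xi>\<close> also holds for \<open>S\<close>.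
  These inequalities survive sums, dilations, joins and limits, and nondegeneracy is itself a family
  of such inequalities (with \<open>n = 1\<close>), which is why limits cannot flatten; so they hold on the
  whole hull. By separation they are equivalent to the intersection formula, whose inclusion in
  \<open>S\<close> already follows from one-term tuples. Conversely, given the inequalities, a finite-dimensional
  Farkas-type alternative yields, for each point \<open>z\<close> of a finite set, a member of the cone that is
  almost below \<open>S\<close> on the set and almost above \<open>S\<close> at \<open>z\<close>; the join of these members
  approximates \<open>S\<close> on the finite set, hence on the sphere.
\<close>

section \<open>Support functions\<close>

lemma supp_fun_upper:
  assumes "compact S" "x \<in> S"
  shows "x \<bullet> z \<le> supp_fun S z"
  unfolding supp_fun_def
proof (rule cSUP_upper[OF assms(2)])
  show "bdd_above ((\<lambda>x. x \<bullet> z) ` S)"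
    by (intro bounded_imp_bdd_above compact_imp_bounded compact_continuous_image
        continuous_intros assms(1))
qed

lemma supp_fun_least:
  assumes "S \<noteq> {}" "\<And>x. x \<in> S \<Longrightarrow> x \<bullet> z \<le> c"
  shows "supp_fun S z \<le> c"
  unfolding supp_fun_def using assms by (intro cSUP_least)

lemma supp_fun_le_iff:
  assumes "S \<in> convex_figures"
  shows "supp_fun S z \<le> c \<longleftrightarrow> (\<forall>x\<in>S. x \<bullet> z \<le> c)"
  using assms supp_fun_upper[of S _ z] supp_fun_least[of S z c]
  unfolding convex_figures_def by fastforce

lemma supp_fun_attained:
  assumes "S \<in> convex_figures"
  obtains x where "x \<in> S" "supp_fun S z = x \<bullet> z"
proof -
  have S: "S \<noteq> {}" "compact S" using assms by (auto simp: convex_figures_def)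
  have "\<exists>x\<in>S. \<forall>y\<in>S. y \<bullet> z \<le> x \<bullet> z"
    by (intro continuous_attains_sup S continuous_intros)
  then obtain x where "x \<in> S" "\<forall>y\<in>S. y \<bullet> z \<le> x \<bullet> z" by blast
  moreover from this have "supp_fun S z = x \<bullet> z"
    using supp_fun_least[of S z "x \<bullet> z"] supp_fun_upper[of S x z] S by (intro antisym) auto
  ultimately show ?thesis using that by blast
qed

lemma supp_fun_zero [simp]: "S \<in> convex_figures \<Longrightarrow> supp_fun S 0 = 0"
  by (rule supp_fun_attained[of S 0]) auto

lemma supp_fun_singleton_zero [simp]: "supp_fun {0} z = 0"
  by (simp add: supp_fun_def)

lemma supp_fun_scaleR:
  assumes "S \<in> convex_figures" "c \<ge> 0"
  shows "supp_fun S (c *\<^sub>R z) = c * supp_fun S z"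
proof (rule antisym)
  have "compact S" using assms by (simp add: convex_figures_def)
  then show "supp_fun S (c *\<^sub>R z) \<le> c * supp_fun S z"
    using assms by (auto simp: supp_fun_le_iff intro!: mult_left_mono supp_fun_upper)
  obtain x where "x \<in> S" "supp_fun S z = x \<bullet> z" using supp_fun_attained assms by blast
  then show "c * supp_fun S z \<le> supp_fun S (c *\<^sub>R z)"
    using supp_fun_upper[OF \<open>compact S\<close>, of x "c *\<^sub>R z"] by simp
qed

lemma supp_fun_add_le:
  assumes "S \<in> convex_figures"
  shows "supp_fun S (y + z) \<le> supp_fun S y + supp_fun S z"
proof -
  have "compact S" using assms by (simp add: convex_figures_def)
  then show ?thesis
    using supp_fun_upper[of S] by (simp add: supp_fun_le_iff[OF assms] inner_add_right add_mono)
qed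

lemma supp_fun_norm_le:
  assumes "S \<in> convex_figures" "\<And>x. x \<in> S \<Longrightarrow> norm x \<le> L"
  shows "supp_fun S z \<le> L * norm z"
  unfolding supp_fun_le_iff[OF assms(1)]
proof
  fix x assume "x \<in> S"
  then show "x \<bullet> z \<le> L * norm z"
    using norm_cauchy_schwarz[of x z] mult_right_mono[OF assms(2)[of x] norm_ge_zero[of z]]
    by linarith
qed

lemma supp_fun_Lipschitz:
  assumes "S \<in> convex_figures" "\<And>x. x \<in> S \<Longrightarrow> norm x \<le> L"
  shows "\<bar>supp_fun S y - supp_fun S z\<bar> \<le> L * norm (y - z)"
proof -
  have "supp_fun S y \<le> supp_fun S z + L * norm (y - z)" for y z
    using supp_fun_add_le[OF assms(1), of z "y - z"] supp_fun_norm_le[OF assms, of "y - z"] by simp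
  from this[of y z] this[of z y] show ?thesis by (simp add: norm_minus_commute abs_le_iff)
qed

lemma continuous_on_supp_fun:
  assumes "S \<in> convex_figures"
  shows "continuous_on A (supp_fun S)"
proof -
  have "bounded S" using assms by (simp add: convex_figures_def compact_imp_bounded)
  then obtain L where "L > 0" and L: "\<And>x. x \<in> S \<Longrightarrow> norm x \<le> L"
    unfolding bounded_pos by blast
  then have "L-lipschitz_on A (supp_fun S)"
    using supp_fun_Lipschitz[OF assms L] by (auto simp: lipschitz_on_def dist_norm)
  then show ?thesis by (rule lipschitz_on_continuous_on)
qed

text \<open>A point outside a closed convex set is strictly separated from it by a hyperplane.
  Membership in a figure thus becomes a family of inequalities between reals.\<close>

lemma mem_iff_supp_fun:
  assumes "S \<in> convex_figures"
  shows "y \<in> S \<longleftrightarrow> (\<forall>z. y \<bullet> z \<le> supp_fun S z)"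
proof
  assume "\<forall>z. y \<bullet> z \<le> supp_fun S z"
  show "y \<in> S"
  proof (rule ccontr)
    assume "y \<notin> S"
    then obtain a b where ab: "a \<bullet> y < b" "\<forall>x\<in>S. a \<bullet> x > b"
      using separating_hyperplane_closed_point[of S y] assms compact_imp_closed
      unfolding convex_figures_def by blast
    \<comment> \<open>Separation puts \<open>S\<close> on the side where \<open>a\<close> is large;
      negating the normal yields an upper bound, which is what a support function records.\<close>
    have "supp_fun S (- a) \<le> - b"
      using ab assms by (auto simp: supp_fun_le_iff inner_commute less_imp_le)
    then show False
      using \<open>\<forall>z. y \<bullet> z \<le> supp_fun S z\<close>[rule_format, of "- a"] ab by (simp add: inner_commute)
  qed
next
  assume "y \<in> S"
  then show "\<forall>z. y \<bullet> z \<le> supp_fun S z"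
    using assms supp_fun_upper by (auto simp: convex_figures_def)
qed

text \<open>One inequality suffices because \<open>z\<close> may be replaced by \<open>- z\<close>.
  In this form symmetry is of the type transferred by \<open>dominated\<close>, with a single vector
  on the right.\<close>

lemma uminus_image_iff_supp_fun:
  assumes "S \<in> convex_figures"
  shows "S = uminus ` S \<longleftrightarrow> (\<forall>z. supp_fun S (- z) \<le> supp_fun S z)"
proof
  assume sym: "S = uminus ` S"
  show "\<forall>z. supp_fun S (- z) \<le> supp_fun S z"
  proof
    fix z
    have "- x \<in> S" if "x \<in> S" for x using sym that by (metis imageI)
    then show "supp_fun S (- z) \<le> supp_fun S z"
      using assms supp_fun_upper[of S _ z]
      by (subst supp_fun_le_iff) (force simp: convex_figures_def)+
  qed
next
  assume le: "\<forall>z. supp_fun S (- z) \<le> supp_fun S z"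
  have neg: "- x \<in> S" if "x \<in> S" for x
    using that le unfolding mem_iff_supp_fun[OF assms]
    by (metis inner_minus_left inner_minus_right order_trans)
  then show "S = uminus ` S" by (metis image_eqI minus_minus subsetI subset_antisym image_subsetI)
qed

section \<open>Dilation, Minkowski sum and join of figures\<close>

lemma dilate_in_figures:
  assumes "S \<in> convex_figures"
  shows "dilate t S \<in> convex_figures"
  using assms unfolding convex_figures_def dilate_def
  by (auto intro: compact_scaling convex_scaling)

lemma plus_in_figures:
  assumes "S \<in> convex_figures" "T \<in> convex_figures"
  shows "S + T \<in> convex_figures"
proof -
  have "S + T = {x + y |x y. x \<in> S \<and> y \<in> T}" by (auto simp: set_plus_def)
  moreover have "compact {x + y |x y. x \<in> S \<and> y \<in> T}"
    using assms by (intro compact_sums) (auto simp: convex_figures_def)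
  ultimately show ?thesis
    using assms convex_set_plus[of S T] by (auto simp: convex_figures_def)
qed

lemma join_in_figures:
  assumes "S \<in> convex_figures" "T \<in> convex_figures"
  shows "join {S, T} \<in> convex_figures"
proof -
  have "compact (S \<union> T)" using assms by (simp add: convex_figures_def compact_Un)
  then have "compact (convex hull (S \<union> T))" by (rule compact_convex_hull)
  moreover from this have "join {S, T} = convex hull (S \<union> T)"
    by (simp add: join_def closure_closed compact_imp_closed)
  ultimately show ?thesis using assms by (simp add: convex_figures_def)
qed

lemma supp_fun_dilate:
  assumes "S \<in> convex_figures" "t \<ge> 0"
  shows "supp_fun (dilate t S) z = t * supp_fun S z"
proof -
  have "supp_fun (dilate t S) z = supp_fun S (t *\<^sub>R z)"
    unfolding supp_fun_def dilate_def by (simp add: image_image)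
  then show ?thesis using supp_fun_scaleR[OF assms] by simp
qed

lemma supp_fun_plus:
  assumes "S \<in> convex_figures" "T \<in> convex_figures"
  shows "supp_fun (S + T) z = supp_fun S z + supp_fun T z"
proof (rule antisym)
  show "supp_fun (S + T) z \<le> supp_fun S z + supp_fun T z"
    using assms supp_fun_upper unfolding supp_fun_le_iff[OF plus_in_figures[OF assms]]
    by (auto simp: set_plus_def inner_add_left convex_figures_def intro!: add_mono)
  obtain x where x: "x \<in> S" "supp_fun S z = x \<bullet> z" using supp_fun_attained assms(1) .
  obtain y where y: "y \<in> T" "supp_fun T z = y \<bullet> z" using supp_fun_attained assms(2) .
  have "compact (S + T)" using plus_in_figures[OF assms] by (simp add: convex_figures_def)
  from supp_fun_upper[OF this set_plus_intro[OF x(1) y(1)], of z]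
  show "supp_fun S z + supp_fun T z \<le> supp_fun (S + T) z"
    by (simp add: x y inner_add_left)
qed

text \<open>A half-space is closed and convex, so it contains the closed convex hull once it
  contains the union. Half-spaces replace \<open>supp_fun\<close> here because the join of an
  arbitrary family may be empty or unbounded.\<close>

lemma join_inner_le_iff:
  "(\<forall>y\<in>join \<S>. y \<bullet> z \<le> c) \<longleftrightarrow> (\<forall>S\<in>\<S>. \<forall>y\<in>S. y \<bullet> z \<le> c)"
proof -
  let ?H = "{y. z \<bullet> y \<le> c}"
  have "join \<S> \<subseteq> ?H \<longleftrightarrow> \<Union>\<S> \<subseteq> ?H"
  proof
    assume "\<Union>\<S> \<subseteq> ?H"
    then have "convex hull \<Union>\<S> \<subseteq> ?H" by (intro hull_minimal convex_halfspace_le)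
    then show "join \<S> \<subseteq> ?H"
      unfolding join_def by (intro closure_minimal closed_halfspace_le)
  next
    assume "join \<S> \<subseteq> ?H"
    then show "\<Union>\<S> \<subseteq> ?H"
      unfolding join_def using hull_subset[of "\<Union>\<S>" convex] closure_subset by blast
  qed
  then show ?thesis by (auto simp: inner_commute subset_iff)
qed

lemma supp_fun_join:
  assumes "S \<in> convex_figures" "T \<in> convex_figures"
  shows "supp_fun (join {S, T}) z = max (supp_fun S z) (supp_fun T z)"
proof -
  have "supp_fun (join {S, T}) z \<le> c \<longleftrightarrow> max (supp_fun S z) (supp_fun T z) \<le> c" for c
    using assms by (simp add: supp_fun_le_iff join_in_figures join_inner_le_iff)
  then show ?thesis by (meson order_antisym order_refl)
qed

section \<open>Balls\<close>

text \<open>The support function attains its minimum over the unit sphere, which is positive by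
  assumption; by homogeneity this minimum serves as the radius.\<close>

lemma cball_subset_figure:
  assumes "S \<in> convex_figures" "\<And>z. z \<noteq> 0 \<Longrightarrow> supp_fun S z > 0"
  obtains \<delta> where "\<delta> > 0" "cball 0 \<delta> \<subseteq> S"
proof -
  have "\<exists>z\<in>sphere 0 1. \<forall>y\<in>sphere 0 1. supp_fun S z \<le> supp_fun S y"
    by (rule continuous_attains_inf) (auto intro: continuous_on_supp_fun assms(1))
  then obtain z where z: "z \<in> sphere 0 1" "\<And>y. y \<in> sphere 0 1 \<Longrightarrow> supp_fun S z \<le> supp_fun S y"
    by blast
  define \<delta> where "\<delta> = supp_fun S z"
  have "\<delta> > 0" unfolding \<delta>_def using z by (intro assms(2)) auto
  moreover have "cball 0 \<delta> \<subseteq> S"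
  proof
    fix y :: "real^'a" assume y: "y \<in> cball 0 \<delta>"
    have "y \<bullet> u \<le> supp_fun S u" for u
    proof (cases "u = 0")
      case False
      have "y \<bullet> u \<le> norm y * norm u" by (rule norm_cauchy_schwarz)
      also have "\<dots> \<le> norm u * \<delta>" using y by (simp add: mult.commute[of _ "norm u"] mult_left_mono)
      also have "\<dots> \<le> norm u * supp_fun S (u /\<^sub>R norm u)"
        unfolding \<delta>_def using False by (intro mult_left_mono z) auto
      also have "\<dots> = supp_fun S u" using False by (simp flip: supp_fun_scaleR[OF assms(1)])
      finally show ?thesis .
    qed (simp add: assms)
    then show "y \<in> S" using mem_iff_supp_fun[OF assms(1)] by blast
  qed
  ultimately show ?thesis by (rule that)
qed

text \<open>A positive dilate of \<open>S\<close> that contains \<open>z\<close> yields a point of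
  \<open>S\<close> with positive inner product with \<open>z\<close>. Conversely, strict positivity
  gives a Euclidean ball inside \<open>S\<close>, which absorbs every vector.\<close>

lemma sym_balls_iff:
  "S \<in> sym_balls \<longleftrightarrow>
     S \<in> convex_figures \<and> S = uminus ` S \<and> (\<forall>z. z \<noteq> 0 \<longrightarrow> supp_fun S z > 0)"
proof -
  have "absorbing S \<longleftrightarrow> (\<forall>z. z \<noteq> 0 \<longrightarrow> supp_fun S z > 0)" if S: "S \<in> convex_figures"
  proof
    assume abs: "absorbing S"
    show "\<forall>z. z \<noteq> 0 \<longrightarrow> supp_fun S z > 0"
    proof (intro allI impI)
      fix z :: "real^'a" assume "z \<noteq> 0"
      obtain a where "a > 0" "z \<in> dilate a S"
        using abs unfolding absorbing_def by (metis abs_ge_self)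
      then obtain y where "y \<in> S" "z = a *\<^sub>R y" by (auto simp: dilate_def)
      then have "y \<bullet> z > 0" using \<open>z \<noteq> 0\<close> \<open>a > 0\<close> by simp
      then show "supp_fun S z > 0"
        using supp_fun_upper[of S y z] S \<open>y \<in> S\<close> by (simp add: convex_figures_def)
    qed
  next
    assume "\<forall>z. z \<noteq> 0 \<longrightarrow> supp_fun S z > 0"
    then obtain \<delta> where \<delta>: "\<delta> > 0" "cball 0 \<delta> \<subseteq> S" using cball_subset_figure[OF S] by blast
    show "absorbing S"
      unfolding absorbing_def
    proof (intro allI exI conjI impI)
      fix x :: "real^'a" and b :: real
      show pos: "norm x / \<delta> + 1 > 0" using \<delta> by (simp add: add_nonneg_pos)
      assume b: "\<bar>b\<bar> \<ge> norm x / \<delta> + 1"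
      then have "b \<noteq> 0" "norm x \<le> \<delta> * \<bar>b\<bar>"
        using pos \<delta> by (auto simp: field_simps)
      then have "norm (x /\<^sub>R b) \<le> \<delta>" by (simp add: field_simps)
      then have "x /\<^sub>R b \<in> S" using \<delta> by (auto simp del: norm_scaleR)
      then show "x \<in> dilate b S"
        unfolding dilate_def using \<open>b \<noteq> 0\<close> by (intro image_eqI[of _ _ "x /\<^sub>R b"]) auto
    qed
  qed
  then show ?thesis by (auto simp: sym_balls_def)
qed

lemma sym_ballsD:
  assumes "S \<in> sym_balls"
  shows "S \<in> convex_figures" "z \<noteq> 0 \<Longrightarrow> supp_fun S z > 0" "supp_fun S z \<ge> 0"
    "supp_fun S (- z) \<le> supp_fun S z" "0 \<in> S"
proof -
  show S: "S \<in> convex_figures" and pos: "z \<noteq> 0 \<Longrightarrow> supp_fun S z > 0" for z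
    using assms by (auto simp: sym_balls_iff)
  show "supp_fun S (- z) \<le> supp_fun S z"
    using assms uminus_image_iff_supp_fun[OF S] by (simp add: sym_balls_iff)
  show nonneg: "supp_fun S z \<ge> 0" for z
    using pos[of z] supp_fun_zero[OF S] by (cases "z = 0") auto
  show "0 \<in> S"
    using nonneg mem_iff_supp_fun[OF S] by simp
qed

section \<open>Gauges and operator norms\<close>

lemma gauge_convex_figure: "S \<in> gauges \<Longrightarrow> S \<in> convex_figures"
  using sym_ballsD(1)[of S] by (auto simp: gauges_def convex_figures_def)

lemma gauge_supp_fun_minus: "S \<in> gauges \<Longrightarrow> supp_fun S (- z) \<le> supp_fun S z"
  using sym_ballsD(4)[of S z] by (auto simp: gauges_def)

text \<open>If \<open>A y /\<^sub>R a\<close> lies in \<open>S\<close>, then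
  \<open>A y \<bullet> z\<close> is at most \<open>a * supp_fun S z\<close>; now take the infimum
  over \<open>a\<close> and the supremum over \<open>y\<close>. As both are taken in the reals,
  nonemptiness and boundedness have to be checked too.\<close>

lemma inner_le_op_norm:
  assumes S: "S \<in> sym_balls" and A: "linear A" and y: "y \<in> S" and z: "z \<noteq> 0"
  shows "A y \<bullet> z \<le> op_norm S A * supp_fun S z"
proof -
  note SD = sym_ballsD[OF S]
  obtain \<delta> where \<delta>: "\<delta> > 0" "cball 0 \<delta> \<subseteq> S" using cball_subset_figure[OF SD(1)] SD(2) by blast
  have bdd: "bdd_below {a. a > 0 \<and> u /\<^sub>R a \<in> S}" for u by (rule bdd_belowI[of _ 0]) auto
  \<comment> \<open>Dividing \<open>u\<close> by this number brings it into the ball of radius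
    \<open>\<delta>\<close>; the added 1 keeps the divisor positive when
    \<open>u = 0\<close>.\<close>
  have mem: "(norm u + 1) / \<delta> \<in> {a. a > 0 \<and> u /\<^sub>R a \<in> S}" for u
  proof -
    have "(norm u + 1) / \<delta> > 0" using \<delta> by (simp add: add_nonneg_pos)
    moreover have "norm (u /\<^sub>R ((norm u + 1) / \<delta>)) \<le> \<delta>"
    proof -
      have "\<delta> * norm u \<le> \<delta> * (norm u + 1)" using \<delta> by simp
      moreover have "norm u + 1 > 0" by (simp add: add_nonneg_pos)
      ultimately show ?thesis using \<delta> by (simp add: divide_le_eq mult.commute)
    qed
    ultimately show ?thesis using \<delta>(2) by (auto simp del: norm_scaleR)
  qed
  have "bounded (A ` S)"
    using SD(1) A by (intro bounded_linear_image compact_imp_bounded linear_linear[THEN iffD2])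
      (auto simp: convex_figures_def)
  then obtain B where B: "\<And>y. y \<in> S \<Longrightarrow> norm (A y) \<le> B" unfolding bounded_iff by blast
  have "gauge_norm S (A y) \<le> (B + 1) / \<delta>" if "y \<in> S" for y
  proof -
    have "gauge_norm S (A y) \<le> (norm (A y) + 1) / \<delta>"
      unfolding gauge_norm_def by (rule cInf_lower[OF mem bdd])
    also have "\<dots> \<le> (B + 1) / \<delta>" using B[OF that] \<delta> by (simp add: divide_right_mono)
    finally show ?thesis .
  qed
  then have le: "gauge_norm S (A y) \<le> op_norm S A"
    unfolding op_norm_def by (intro cSUP_upper y bdd_aboveI2)
  have pos: "supp_fun S z > 0" by (rule SD(2)[OF z])
  have "A y \<bullet> z / supp_fun S z \<le> gauge_norm S (A y)"
    unfolding gauge_norm_def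
  proof (rule cInf_greatest)
    show "{a. a > 0 \<and> A y /\<^sub>R a \<in> S} \<noteq> {}" using mem by blast
    fix a assume "a \<in> {a. a > 0 \<and> A y /\<^sub>R a \<in> S}"
    then have "a > 0" "(A y /\<^sub>R a) \<bullet> z \<le> supp_fun S z"
      using mem_iff_supp_fun[OF SD(1)] by blast+
    then show "A y \<bullet> z / supp_fun S z \<le> a" using pos by (simp add: field_simps)
  qed
  with le have "A y \<bullet> z / supp_fun S z \<le> op_norm S A" by linarith
  then show ?thesis using pos by (simp add: field_simps)
qed

text \<open>Nondegeneracy is applied to an operator of rank one with range spanned by
  \<open>z\<close>, normalised so that its value at \<open>y\<close> has inner product
  \<open>y \<bullet> x\<close> with \<open>z\<close>. The constant is common to the whole
  family.\<close>

lemma nondegenerate_supp_fun_bound: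
  assumes "nondegenerate \<Xi> F" "z \<noteq> 0"
  obtains c where "c \<ge> 0" "\<And>\<xi>. \<xi> \<in> \<Xi> \<Longrightarrow> supp_fun (F \<xi>) x \<le> c * supp_fun (F \<xi>) z"
proof -
  define A where "A y = (y \<bullet> x / (z \<bullet> z)) *\<^sub>R z" for y
  have A: "linear A"
    unfolding A_def by (rule linearI) (auto simp: inner_add_left add_divide_distrib scaleR_add_left)
  then obtain c where c: "\<And>\<xi>. \<xi> \<in> \<Xi> \<Longrightarrow> op_norm (F \<xi>) A \<le> c"
    using assms(1) unfolding nondegenerate_def bdd_above_def by fastforce
  have ball: "F \<xi> \<in> sym_balls" if "\<xi> \<in> \<Xi>" for \<xi> using assms(1) that by (simp add: nondegenerate_def)
  \<comment> \<open>Truncation at 0 gives a nonnegative constant, which homogeneity can absorb into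
    \<open>z\<close>; for an empty family nothing else fixes the sign of \<open>c\<close>.\<close>
  have "supp_fun (F \<xi>) x \<le> max 0 c * supp_fun (F \<xi>) z" if \<xi>: "\<xi> \<in> \<Xi>" for \<xi>
    unfolding supp_fun_le_iff[OF sym_ballsD(1)[OF ball[OF \<xi>]]]
  proof
    fix y assume "y \<in> F \<xi>"
    have "y \<bullet> x = A y \<bullet> z" using assms(2) by (simp add: A_def)
    also have "\<dots> \<le> op_norm (F \<xi>) A * supp_fun (F \<xi>) z"
      by (rule inner_le_op_norm[OF ball[OF \<xi>] A \<open>y \<in> F \<xi>\<close> assms(2)])
    also have "\<dots> \<le> max 0 c * supp_fun (F \<xi>) z"
      using c[OF \<xi>] sym_ballsD(3)[OF ball[OF \<xi>]] by (intro mult_right_mono) auto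
    finally show "y \<bullet> x \<le> max 0 c * supp_fun (F \<xi>) z" .
  qed
  then show ?thesis by (intro that[of "max 0 c"]) auto
qed

section \<open>Functional inequalities of the family\<close>

text \<open>Nonnegative weights are covered as well, since positive homogeneity absorbs them into
  the vectors. The empty list is included: for an empty family it leaves only \<open>{0}\<close>
  among the figures.\<close>

definition dominated :: "'i set \<Rightarrow> ('i \<Rightarrow> (real^'n) set) \<Rightarrow> (real^'n) set \<Rightarrow> bool" where
  "dominated \<Xi> F T \<longleftrightarrow>
     (\<forall>z xs. (\<forall>\<xi>\<in>\<Xi>. supp_fun (F \<xi>) z \<le> (\<Sum>x\<leftarrow>xs. supp_fun (F \<xi>) x)) \<longrightarrow>
             supp_fun T z \<le> (\<Sum>x\<leftarrow>xs. supp_fun T x))"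

lemma dominatedD:
  assumes "dominated \<Xi> F T" "\<And>\<xi>. \<xi> \<in> \<Xi> \<Longrightarrow> supp_fun (F \<xi>) z \<le> (\<Sum>x\<leftarrow>xs. supp_fun (F \<xi>) x)"
  shows "supp_fun T z \<le> (\<Sum>x\<leftarrow>xs. supp_fun T x)"
  using assms unfolding dominated_def by blast

lemma supp_fun_sum_scaleR:
  assumes "S \<in> convex_figures" "c \<ge> 0"
  shows "(\<Sum>x\<leftarrow>map ((*\<^sub>R) c) xs. supp_fun S x) = c * (\<Sum>x\<leftarrow>xs. supp_fun S x)"
  using assms by (simp add: supp_fun_scaleR comp_def sum_list_const_mult)

text \<open>Comparing \<open>- z\<close> with \<open>z\<close> gives symmetry. Comparing an
  arbitrary \<open>x\<close> with a multiple of \<open>z\<close> shows that a support function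
  vanishing at one nonzero \<open>z\<close> vanishes everywhere, so the only alternative to a ball
  is \<open>{0}\<close>.\<close>

lemma dominated_gauge:
  assumes nd: "nondegenerate \<Xi> F" and T: "T \<in> convex_figures" and dom: "dominated \<Xi> F T"
  shows "T \<in> gauges"
proof -
  have ball: "F \<xi> \<in> sym_balls" if "\<xi> \<in> \<Xi>" for \<xi> using nd that by (simp add: nondegenerate_def)
  have minus: "supp_fun T (- z) \<le> supp_fun T z" for z
    using dominatedD[OF dom, of "- z" "[z]"] sym_ballsD(4)[OF ball] by auto
  have nonneg: "supp_fun T z \<ge> 0" for z
    using supp_fun_add_le[OF T, of z "- z"] minus[of z] T by simp
  show ?thesis
  proof (cases "\<forall>z. z \<noteq> 0 \<longrightarrow> supp_fun T z > 0")
    case True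
    then have "T \<in> sym_balls" using minus T by (simp add: sym_balls_iff uminus_image_iff_supp_fun)
    then show ?thesis by (simp add: gauges_def)
  next
    case False
    then obtain z where z: "z \<noteq> 0" "supp_fun T z = 0" using nonneg by (metis order_le_less)
    have zero: "supp_fun T x = 0" for x
    proof -
      obtain c where c: "c \<ge> 0" "\<And>\<xi>. \<xi> \<in> \<Xi> \<Longrightarrow> supp_fun (F \<xi>) x \<le> c * supp_fun (F \<xi>) z"
        using nondegenerate_supp_fun_bound[OF nd z(1)] by blast
      then have "supp_fun T x \<le> supp_fun T (c *\<^sub>R z)"
        using dominatedD[OF dom, of x "[c *\<^sub>R z]"] sym_ballsD(1)[OF ball]
        by (simp add: supp_fun_scaleR)
      then show ?thesis using nonneg[of x] z T c by (simp add: supp_fun_scaleR)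
    qed
    have "y \<in> T \<longleftrightarrow> y = 0" for y
      unfolding mem_iff_supp_fun[OF T] zero by (metis inner_eq_zero_iff inner_gt_zero_iff inner_zero_left leD order_refl)
    then show ?thesis by (auto simp: gauges_def)
  qed
qed

section \<open>Stability of the inequalities under cone operations, joins and limits\<close>

lemma dominated_plus:
  assumes "S \<in> convex_figures" "T \<in> convex_figures" "dominated \<Xi> F S" "dominated \<Xi> F T"
  shows "dominated \<Xi> F (S + T)"
proof -
  have "supp_fun (S + T) = (\<lambda>x. supp_fun S x + supp_fun T x)" using assms by (auto simp: supp_fun_plus)
  then show ?thesis
    using assms(3,4) unfolding dominated_def by (auto simp: sum_list_addf intro!: add_mono)
qed

lemma dominated_dilate:
  assumes "S \<in> convex_figures" "dominated \<Xi> F S" "t \<ge> 0"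
  shows "dominated \<Xi> F (dilate t S)"
proof -
  have "supp_fun (dilate t S) = (\<lambda>x. t * supp_fun S x)" using assms by (auto simp: supp_fun_dilate)
  then show ?thesis
    using assms(2,3) unfolding dominated_def by (auto simp: sum_list_const_mult intro!: mult_left_mono)
qed

text \<open>Each of the two support functions at \<open>z\<close> is bounded by its own sum, hence
  by the sum of the pointwise maxima.\<close>

lemma dominated_join:
  assumes "S \<in> convex_figures" "T \<in> convex_figures" "dominated \<Xi> F S" "dominated \<Xi> F T"
  shows "dominated \<Xi> F (join {S, T})"
  unfolding dominated_def
proof (intro allI impI)
  fix z xs
  assume *: "\<forall>\<xi>\<in>\<Xi>. supp_fun (F \<xi>) z \<le> (\<Sum>x\<leftarrow>xs. supp_fun (F \<xi>) x)"
  let ?m = "\<lambda>x. max (supp_fun S x) (supp_fun T x)"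
  have "supp_fun S z \<le> (\<Sum>x\<leftarrow>xs. supp_fun S x)" "supp_fun T z \<le> (\<Sum>x\<leftarrow>xs. supp_fun T x)"
    using * assms(3,4) unfolding dominated_def by blast+
  moreover have "(\<Sum>x\<leftarrow>xs. supp_fun S x) \<le> (\<Sum>x\<leftarrow>xs. ?m x)" "(\<Sum>x\<leftarrow>xs. supp_fun T x) \<le> (\<Sum>x\<leftarrow>xs. ?m x)"
    by (auto intro: sum_list_mono)
  ultimately show "supp_fun (join {S, T}) z \<le> (\<Sum>x\<leftarrow>xs. supp_fun (join {S, T}) x)"
    using supp_fun_join[OF assms(1,2)] by (simp cong: map_cong)
qed

text \<open>Positive homogeneity carries the limit from the sphere along each ray; the origin cannot
  be normalised and is treated apart.\<close>

lemma tendsto_supp_fun: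
  assumes F: "\<And>n. F n \<in> convex_figures" and T: "T \<in> convex_figures"
    and lim: "uniform_limit (sphere 0 1) (\<lambda>n. supp_fun (F n)) (supp_fun T) sequentially"
  shows "(\<lambda>n. supp_fun (F n) z) \<longlonglongrightarrow> supp_fun T z"
proof (cases "z = 0")
  case True
  then show ?thesis using assms by simp
next
  case False
  have "(\<lambda>n. supp_fun (F n) (z /\<^sub>R norm z)) \<longlonglongrightarrow> supp_fun T (z /\<^sub>R norm z)"
    using False by (intro tendsto_uniform_limitI[OF lim]) auto
  then have "(\<lambda>n. norm z * supp_fun (F n) (z /\<^sub>R norm z)) \<longlonglongrightarrow> norm z * supp_fun T (z /\<^sub>R norm z)"
    by (intro tendsto_intros)
  then show ?thesis
    using False by (simp flip: supp_fun_scaleR[OF F] supp_fun_scaleR[OF T])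
qed

text \<open>Each inequality involves finitely many support values, so pointwise convergence is
  enough to pass to the limit.\<close>

lemma closed_figures_dominated:
  fixes F :: "'i \<Rightarrow> (real^'n) set"
  shows "closed_figures {T \<in> convex_figures. dominated \<Xi> F T}"
  unfolding closed_figures_def
proof (intro allI ballI impI)
  fix G :: "nat \<Rightarrow> (real^'n) set" and T
  assume T: "T \<in> convex_figures" and G: "\<forall>n. G n \<in> {T \<in> convex_figures. dominated \<Xi> F T}"
    and lim: "uniform_limit (sphere 0 1) (\<lambda>n. supp_fun (G n)) (supp_fun T) sequentially"
  have pt: "(\<lambda>n. supp_fun (G n) z) \<longlonglongrightarrow> supp_fun T z" for z
    using G by (intro tendsto_supp_fun T lim) auto
  have pts: "(\<lambda>n. \<Sum>x\<leftarrow>xs. supp_fun (G n) x) \<longlonglongrightarrow> (\<Sum>x\<leftarrow>xs. supp_fun T x)" for xs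
    by (induction xs) (auto intro: tendsto_add pt)
  have "dominated \<Xi> F T"
    unfolding dominated_def
  proof (intro allI impI)
    fix z xs
    assume "\<forall>\<xi>\<in>\<Xi>. supp_fun (F \<xi>) z \<le> (\<Sum>x\<leftarrow>xs. supp_fun (F \<xi>) x)"
    then have "supp_fun (G n) z \<le> (\<Sum>x\<leftarrow>xs. supp_fun (G n) x)" for n
      using G unfolding dominated_def by blast
    then show "supp_fun T z \<le> (\<Sum>x\<leftarrow>xs. supp_fun T x)"
      by (intro LIMSEQ_le[OF pt pts]) auto
  qed
  then show "T \<in> {T \<in> convex_figures. dominated \<Xi> F T}" using T by simp
qed

text \<open>The dominated figures form a class of the kind over which the hull is taken, so they
  contain the hull. Nondegeneracy ensures that all of them are gauges.\<close>

lemma upper_hull_imp_dominated: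
  assumes nd: "nondegenerate \<Xi> F" and S: "S \<in> upper_hull \<Xi> F"
  shows "dominated \<Xi> F S"
proof -
  let ?K = "{T \<in> convex_figures. dominated \<Xi> F T}"
  have "upper_hull \<Xi> F \<subseteq> ?K"
    unfolding upper_hull_def
  proof (rule hull_minimal, goal_cases)
    case 1
    show ?case
      using nd by (auto simp: nondegenerate_def dominated_def intro: sym_ballsD(1))
  next
    case 2
    \<comment> \<open>A cone must be nonempty, and \<open>{0}\<close> is a member even when the
      family is empty.\<close>
    have "{0} \<in> ?K" by (simp add: convex_figures_def dominated_def cong: map_cong)
    then have "cone_of_figures ?K"
      unfolding cone_of_figures_def
      by (auto intro: plus_in_figures dilate_in_figures dominated_plus dominated_dilate)
    moreover have "join {T, U} \<in> ?K" if "T \<in> ?K" "U \<in> ?K" for T U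
      using that by (auto intro: join_in_figures dominated_join)
    ultimately show ?case
      using dominated_gauge[OF nd] closed_figures_dominated[of \<Xi> F] by blast
  qed
  then show ?thesis using S by blast
qed

text \<open>Half-spaces containing the join for a tuple correspond to inequalities of the family
  whose right-hand side is a multiple of the sum over that tuple. Separation therefore turns the
  inclusion of \<open>S\<close> in every term into \<open>dominated\<close>.\<close>

lemma dominated_iff_meet:
  assumes ball: "\<And>\<xi>. \<xi> \<in> \<Xi> \<Longrightarrow> F \<xi> \<in> sym_balls" and S: "S \<in> sym_balls"
  shows "dominated \<Xi> F S \<longleftrightarrow>
    S = (\<Inter>xs\<in>{xs. \<exists>x\<in>set xs. x \<noteq> 0}.
          dilate (\<Sum>x\<leftarrow>xs. supp_fun S x)
            (join ((\<lambda>\<xi>. dilate (1 / (\<Sum>x\<leftarrow>xs. supp_fun (F \<xi>) x)) (F \<xi>)) ` \<Xi>)))"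
    (is "_ \<longleftrightarrow> S = (\<Inter>xs\<in>?X. dilate (?s xs) (?J xs))")
proof -
  note SD = sym_ballsD[OF S]
  note FD = sym_ballsD[OF ball]
  have sum_pos: "(\<Sum>x\<leftarrow>xs. supp_fun T x) > 0" if "xs \<in> ?X" "T \<in> sym_balls" for T and xs :: "(real^'b) list"
  proof -
    obtain x where x: "x \<in> set xs" "x \<noteq> 0" using \<open>xs \<in> ?X\<close> by blast
    have "supp_fun T x \<le> (\<Sum>x\<leftarrow>xs. supp_fun T x)"
      using x sym_ballsD(3)[OF that(2)] by (intro member_le_sum_list) auto
    then show ?thesis using sym_ballsD(2)[OF that(2) x(2)] by linarith
  qed
  have J_le: "(\<forall>y\<in>?J xs. y \<bullet> z \<le> m) \<longleftrightarrow>
      (\<forall>\<xi>\<in>\<Xi>. supp_fun (F \<xi>) z \<le> m * (\<Sum>x\<leftarrow>xs. supp_fun (F \<xi>) x))" if "xs \<in> ?X" for xs z m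
    unfolding join_inner_le_iff
    using sum_pos[OF that ball] FD(1)
    by (auto simp: dilate_def supp_fun_le_iff field_simps)
  have meet_sub: "(\<Inter>xs\<in>?X. dilate (?s xs) (?J xs)) \<subseteq> S"
  proof
    fix y assume y: "y \<in> (\<Inter>xs\<in>?X. dilate (?s xs) (?J xs))"
    have "y \<bullet> z \<le> supp_fun S z" for z
    proof (cases "z = 0")
      case False
      \<comment> \<open>For the tuple consisting of \<open>z\<close> alone, all figures in the join
        are normalised at \<open>z\<close>, so the join lies in the half-space
        \<open>u \<bullet> z \<le> 1\<close>.\<close>
      then have z: "[z] \<in> ?X" by simp
      then obtain u where u: "u \<in> ?J [z]" "y = supp_fun S z *\<^sub>R u"
      proof -
        have "y \<in> dilate (?s [z]) (?J [z])" using y z by blast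
        then show ?thesis using that by (auto simp: dilate_def)
      qed
      have "u \<bullet> z \<le> 1" using J_le[OF z, of z 1] u(1) by simp
      then show ?thesis
        using u(2) mult_left_mono[OF _ SD(3), of "u \<bullet> z" 1 z] by simp
    qed (simp add: SD(1))
    then show "y \<in> S" using mem_iff_supp_fun[OF SD(1)] by blast
  qed
  show ?thesis
  proof
    assume dom: "dominated \<Xi> F S"
    \<comment> \<open>For an empty family the empty list would make the support function of the ball
      \<open>S\<close> nonpositive.\<close>
    have "\<Xi> \<noteq> {}"
    proof
      assume "\<Xi> = {}"
      then have "supp_fun S (axis undefined 1) \<le> 0" using dominatedD[OF dom, of _ "[]"] by simp
      then show False using SD(2)[of "axis undefined 1"] by (simp add: axis_eq_0_iff)
    qed
    have "y \<in> dilate (?s xs) (?J xs)" if y: "y \<in> S" and xs: "xs \<in> ?X" for y xs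
    proof (rule ccontr)
      assume nin: "y \<notin> dilate (?s xs) (?J xs)"
      have s: "?s xs > 0" by (rule sum_pos[OF xs S])
      have "y /\<^sub>R ?s xs \<notin> ?J xs"
      proof
        assume "y /\<^sub>R ?s xs \<in> ?J xs"
        then have "?s xs *\<^sub>R (y /\<^sub>R ?s xs) \<in> dilate (?s xs) (?J xs)"
          unfolding dilate_def by (rule imageI)
        then show False using nin s by simp
      qed
      moreover have "convex (?J xs)" "closed (?J xs)"
        by (simp_all add: join_def convex_closure)
      ultimately obtain a b where ab: "a \<bullet> (y /\<^sub>R ?s xs) < b" "\<forall>u\<in>?J xs. a \<bullet> u > b"
        using separating_hyperplane_closed_point by blast
      obtain \<xi> where "\<xi> \<in> \<Xi>" using \<open>\<Xi> \<noteq> {}\<close> by blast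
      have le: "\<forall>\<xi>\<in>\<Xi>. supp_fun (F \<xi>) (- a) \<le> - b * (\<Sum>x\<leftarrow>xs. supp_fun (F \<xi>) x)"
        using J_le[OF xs, of "- a" "- b"] ab(2) by (auto simp: inner_commute less_imp_le)
      \<comment> \<open>Any one member of the family reveals the sign of \<open>b\<close>, which
        allows \<open>- b\<close> to be moved into the vectors of the list.\<close>
      have "0 \<le> - b * (\<Sum>x\<leftarrow>xs. supp_fun (F \<xi>) x)"
        using le \<open>\<xi> \<in> \<Xi>\<close> FD(3)[OF \<open>\<xi> \<in> \<Xi>\<close>, of "- a"] by force
      then have b: "- b \<ge> 0"
        using sum_pos[OF xs ball[OF \<open>\<xi> \<in> \<Xi>\<close>]] by (simp add: mult_le_0_iff)
      have "supp_fun S (- a) \<le> (\<Sum>x\<leftarrow>map ((*\<^sub>R) (- b)) xs. supp_fun S x)"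
        using le by (intro dominatedD[OF dom]) (simp only: supp_fun_sum_scaleR[OF FD(1) b])
      also have "\<dots> = - b * ?s xs" by (rule supp_fun_sum_scaleR[OF SD(1) b])
      finally have "y \<bullet> (- a) \<le> - b * ?s xs"
        using supp_fun_le_iff[OF SD(1)] y by blast
      then show False using ab(1) s by (simp add: inner_commute field_simps)
    qed
    then show "S = (\<Inter>xs\<in>?X. dilate (?s xs) (?J xs))" using meet_sub by blast
  next
    assume eq: "S = (\<Inter>xs\<in>?X. dilate (?s xs) (?J xs))"
    show "dominated \<Xi> F S"
      unfolding dominated_def
    proof (intro allI impI)
      fix z xs
      assume le: "\<forall>\<xi>\<in>\<Xi>. supp_fun (F \<xi>) z \<le> (\<Sum>x\<leftarrow>xs. supp_fun (F \<xi>) x)"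
      show "supp_fun S z \<le> ?s xs"
      proof (cases "xs \<in> ?X")
        case True
        have "y \<bullet> z \<le> ?s xs" if "y \<in> S" for y
        proof -
          have "y \<in> dilate (?s xs) (?J xs)" using eq that True by blast
          then obtain u where u: "u \<in> ?J xs" "y = ?s xs *\<^sub>R u" by (auto simp: dilate_def)
          have "u \<bullet> z \<le> 1" using J_le[OF True, of z 1] le u(1) by simp
          then show ?thesis
            using u(2) mult_left_mono[of "u \<bullet> z" 1 "?s xs"] sum_pos[OF True S] by simp
        qed
        then show ?thesis by (simp add: supp_fun_le_iff SD(1))
      next
        case False
        \<comment> \<open>Lists of zero vectors do not occur in the intersection. Their sums vanish,
          so any member of the family forces \<open>z = 0\<close>; a member exists, since otherwise
          every join would be empty although \<open>S\<close> contains the origin.\<close>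
        have "\<Xi> \<noteq> {}"
        proof
          assume "\<Xi> = {}"
          have "[axis undefined 1] \<in> ?X" by (simp add: axis_eq_0_iff)
          then have "S \<subseteq> dilate (?s [axis undefined 1]) (?J [axis undefined 1])" using eq by blast
          then have "S \<subseteq> {}" by (simp add: \<open>\<Xi> = {}\<close> join_def dilate_def)
          then show False using SD(5) by blast
        qed
        then obtain \<xi> where \<xi>: "\<xi> \<in> \<Xi>" by blast
        have zero: "(\<Sum>x\<leftarrow>xs. supp_fun T x) = 0" if "T \<in> convex_figures" for T
        proof -
          have "\<forall>x\<in>set xs. supp_fun T x = 0" using False that by auto
          then show ?thesis by (simp cong: map_cong)
        qed
        have "supp_fun (F \<xi>) z \<le> 0" using le \<xi> zero[OF FD(1)] by force
        then have "z = 0" using FD(2)[OF \<xi>, of z] by fastforce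
        then show ?thesis using zero SD(1) by simp
      qed
    qed
  qed
qed

section \<open>Approximation by members of the hull\<close>

text \<open>The class need only be convex up to domination, which is what survives the restriction
  to the members negative at one index.\<close>

lemma convexlike_alternative:
  fixes f :: "'a \<Rightarrow> 'k \<Rightarrow> real"
  assumes "finite I" "I \<noteq> {}"
    and "\<And>x y t. x \<in> X \<Longrightarrow> y \<in> X \<Longrightarrow> 0 \<le> t \<Longrightarrow> t \<le> 1 \<Longrightarrow>
           \<exists>w\<in>X. \<forall>i\<in>I. f w i \<le> (1 - t) * f x i + t * f y i"
    and "\<And>x. x \<in> X \<Longrightarrow> \<exists>i\<in>I. f x i \<ge> 0"
  shows "\<exists>\<mu>. (\<forall>i\<in>I. \<mu> i \<ge> 0) \<and> (\<exists>i\<in>I. \<mu> i > 0) \<and> (\<forall>x\<in>X. (\<Sum>i\<in>I. \<mu> i * f x i) \<ge> 0)"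
  using assms
proof (induction I arbitrary: X rule: finite_ne_induct)
  case (singleton i)
  then show ?case by (intro exI[of _ "\<lambda>_. 1"]) auto
next
  case (insert j I)
  note conv = insert.prems(1) and alt = insert.prems(2)
  \<comment> \<open>On these members the nonnegative value promised by the hypothesis must occur at
    an index in \<open>I\<close>.\<close>
  let ?Y = "{x \<in> X. f x j < 0}"
  have "\<exists>\<mu>. (\<forall>i\<in>I. \<mu> i \<ge> 0) \<and> (\<exists>i\<in>I. \<mu> i > 0) \<and> (\<forall>x\<in>?Y. (\<Sum>i\<in>I. \<mu> i * f x i) \<ge> 0)"
  proof (rule insert.IH)
    show "\<exists>i\<in>I. f x i \<ge> 0" if "x \<in> ?Y" for x using alt[of x] that by auto
    fix x y and t :: real assume xy: "x \<in> ?Y" "y \<in> ?Y" and t: "0 \<le> t" "t \<le> 1"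
    obtain w where w: "w \<in> X" "\<forall>i\<in>insert j I. f w i \<le> (1 - t) * f x i + t * f y i"
      using conv[of x y t] xy t by blast
    have "(1 - t) * f x j + t * f y j < 0"
      using xy t convex_bound_lt[of "f x j" 0 "f y j" "1 - t" t] by simp
    then have "w \<in> ?Y" using w by fastforce
    then show "\<exists>w\<in>?Y. \<forall>i\<in>I. f w i \<le> (1 - t) * f x i + t * f y i" using w by blast
  qed
  then obtain \<mu> where \<mu>: "\<forall>i\<in>I. \<mu> i \<ge> 0" "\<exists>i\<in>I. \<mu> i > 0"
      "\<And>x. x \<in> X \<Longrightarrow> f x j < 0 \<Longrightarrow> (\<Sum>i\<in>I. \<mu> i * f x i) \<ge> 0" by blast
  define g where "g x = (\<Sum>i\<in>I. \<mu> i * f x i)" for x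
  \<comment> \<open>\<open>A\<close> is the upward closure of the image of \<open>X\<close> under
    \<open>g\<close> and the \<open>j\<close>-th function. The image need not be convex, but its
    upward closure is; it misses the open negative quadrant \<open>B\<close> by the choice of
    \<open>\<mu>\<close>.\<close>
  define A where "A = {(a, b). \<exists>x\<in>X. g x \<le> a \<and> f x j \<le> b}"
  define B where "B = {..<0::real} \<times> {..<0::real}"
  show ?case
  proof (cases "X = {}")
    case True
    then show ?thesis by (intro exI[of _ "\<lambda>_. 1"]) auto
  next
    case False
    then have "A \<noteq> {}" unfolding A_def by blast
    have "B \<noteq> {}" "convex B" unfolding B_def by (auto intro: convex_Times lt_ex)
    have "A \<inter> B = {}"
      using \<mu>(3) unfolding A_def B_def g_def[symmetric] by fastforce
    have "convex A"
      unfolding convex_alt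
    proof (intro ballI allI impI)
      fix p q and t :: real assume p: "p \<in> A" and q: "q \<in> A" and t: "0 \<le> t \<and> t \<le> 1"
      obtain x where x: "x \<in> X" "g x \<le> fst p" "f x j \<le> snd p" using p by (auto simp: A_def)
      obtain y where y: "y \<in> X" "g y \<le> fst q" "f y j \<le> snd q" using q by (auto simp: A_def)
      obtain w where w: "w \<in> X" "\<forall>i\<in>insert j I. f w i \<le> (1 - t) * f x i + t * f y i"
        using conv[of x y t] x y t by blast
      have "g w \<le> (\<Sum>i\<in>I. \<mu> i * ((1 - t) * f x i + t * f y i))"
        unfolding g_def using w \<mu> by (intro sum_mono mult_left_mono) auto
      also have "\<dots> = (1 - t) * g x + t * g y"
        by (simp add: g_def distrib_left sum.distrib sum_distrib_left mult.left_commute)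
      also have "\<dots> \<le> (1 - t) * fst p + t * fst q"
        using x y t by (intro add_mono mult_left_mono) auto
      finally have "g w \<le> (1 - t) * fst p + t * fst q" .
      moreover have "f w j \<le> (1 - t) * f x j + t * f y j" using w by blast
      moreover have "\<dots> \<le> (1 - t) * snd p + t * snd q"
        using x y t by (intro add_mono mult_left_mono) auto
      ultimately show "(1 - t) *\<^sub>R p + t *\<^sub>R q \<in> A"
        unfolding A_def using w(1) by (auto simp: case_prod_beta)
    qed
    then obtain c d where cd: "c \<noteq> 0" "\<forall>p\<in>B. c \<bullet> p \<le> d" "\<forall>p\<in>A. c \<bullet> p \<ge> d"
      using separating_hyperplane_sets[OF \<open>convex B\<close> _ \<open>B \<noteq> {}\<close> \<open>A \<noteq> {}\<close>] \<open>A \<inter> B = {}\<close> by blast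
    obtain \<alpha> \<beta> where c: "c = (\<alpha>, \<beta>)" by (cases c)
    have lt: "\<alpha> * a + \<beta> * b \<le> d" if "a < 0" "b < 0" for a b
      using cd(2) that by (auto simp: B_def c)
    \<comment> \<open>The corner of the quadrant is approached along the diagonal.\<close>
    have "d \<ge> 0"
    proof (rule LIMSEQ_le_const2)
      show "(\<lambda>n. - (\<alpha> + \<beta>) * inverse (real (Suc n))) \<longlonglongrightarrow> 0"
        by (rule tendsto_mult_right_zero[OF LIMSEQ_inverse_real_of_nat])
      have "- (\<alpha> + \<beta>) * inverse (real (Suc n)) \<le> d" for n
        using lt[of "- inverse (real (Suc n))" "- inverse (real (Suc n))"]
        by (simp add: algebra_simps del: of_nat_Suc)
      then show "\<exists>N. \<forall>n\<ge>N. - (\<alpha> + \<beta>) * inverse (real (Suc n)) \<le> d" by blast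
    qed
    \<comment> \<open>\<open>A\<close> is unbounded upwards in the first coordinate. For negative
      \<open>\<alpha>\<close> the shift \<open>s\<close> below brings the separating functional down
      to at most -1, against \<open>d \<ge> 0\<close>. The second coordinate is handled in the same
      way.\<close>
    have "\<alpha> \<ge> 0"
    proof (rule ccontr)
      assume "\<not> \<alpha> \<ge> 0"
      obtain x where "x \<in> X" using False by blast
      then have A: "(g x + s, f x j) \<in> A" if "s \<ge> 0" for s using that by (auto simp: A_def intro!: bexI[of _ x])
      define s where "s = (\<bar>\<alpha> * g x + \<beta> * f x j\<bar> + 1) / - \<alpha>"
      have "s \<ge> 0" "\<alpha> * s = - (\<bar>\<alpha> * g x + \<beta> * f x j\<bar> + 1)"
        using \<open>\<not> \<alpha> \<ge> 0\<close> by (auto simp: s_def divide_nonneg_neg field_simps)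
      then show False using cd(3) A[of s] \<open>d \<ge> 0\<close> by (force simp: c distrib_left)
    qed
    have "\<beta> \<ge> 0"
    proof (rule ccontr)
      assume "\<not> \<beta> \<ge> 0"
      obtain x where "x \<in> X" using False by blast
      then have A: "(g x, f x j + s) \<in> A" if "s \<ge> 0" for s using that by (auto simp: A_def intro!: bexI[of _ x])
      define s where "s = (\<bar>\<alpha> * g x + \<beta> * f x j\<bar> + 1) / - \<beta>"
      have "s \<ge> 0" "\<beta> * s = - (\<bar>\<alpha> * g x + \<beta> * f x j\<bar> + 1)"
        using \<open>\<not> \<beta> \<ge> 0\<close> by (auto simp: s_def divide_nonneg_neg field_simps)
      then show False using cd(3) A[of s] \<open>d \<ge> 0\<close> by (force simp: c distrib_left)
    qed
    \<comment> \<open>These weights compose the separating functional with the weights of the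
      induction hypothesis.\<close>
    define \<nu> where "\<nu> i = (if i = j then \<beta> else \<alpha> * \<mu> i)" for i
    have "(\<Sum>i\<in>insert j I. \<nu> i * f x i) = \<beta> * f x j + \<alpha> * g x" for x
    proof -
      have "(\<Sum>i\<in>I. \<nu> i * f x i) = (\<Sum>i\<in>I. \<alpha> * (\<mu> i * f x i))"
        using insert.hyps by (intro sum.cong) (auto simp: \<nu>_def)
      then show ?thesis using insert.hyps by (simp add: \<nu>_def g_def sum_distrib_left)
    qed
    moreover have "\<beta> * f x j + \<alpha> * g x \<ge> 0" if "x \<in> X" for x
    proof -
      have "(g x, f x j) \<in> A" using that by (auto simp: A_def intro!: bexI[of _ x])
      then show ?thesis using cd(3) \<open>d \<ge> 0\<close> by (force simp: c)
    qed
    moreover have "\<exists>i\<in>insert j I. \<nu> i > 0"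
    proof (cases "\<beta> > 0")
      case True
      then show ?thesis by (auto simp: \<nu>_def)
    next
      case False
      then have "\<alpha> > 0" using \<open>\<alpha> \<ge> 0\<close> \<open>\<beta> \<ge> 0\<close> cd(1) c by (auto simp: zero_prod_def)
      obtain i where "i \<in> I" "\<mu> i > 0" using \<mu>(2) by blast
      moreover from this have "i \<noteq> j" using insert.hyps by blast
      ultimately show ?thesis using \<open>\<alpha> > 0\<close> by (auto simp: \<nu>_def)
    qed
    moreover have "\<forall>i\<in>insert j I. \<nu> i \<ge> 0"
      using \<open>\<alpha> \<ge> 0\<close> \<open>\<beta> \<ge> 0\<close> \<mu>(1) by (auto simp: \<nu>_def)
    ultimately show ?thesis by (intro exI[of _ \<nu>]) auto
  qed
qed

text \<open>Otherwise the alternative gives nonnegative weights, not all zero, for which the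
  weighted sum of the violations is nonnegative on the cone. Large dilates extract from it an
  inequality valid on \<open>K\<close>, and the zero dilate shows that \<open>S\<close> violates
  this inequality, contrary to domination.\<close>

lemma approximation_at_point:
  assumes K: "K \<subseteq> convex_figures" "cone_of_figures K" "F ` \<Xi> \<subseteq> K"
    and S: "S \<in> convex_figures" "dominated \<Xi> F S"
    and Z: "finite Z" and \<epsilon>: "\<epsilon> > 0"
  shows "\<exists>T\<in>K. supp_fun T z > supp_fun S z - \<epsilon> \<and> (\<forall>x\<in>Z. supp_fun T x < supp_fun S x + \<epsilon>)"
proof (rule ccontr)
  assume contra: "\<not> ?thesis"
  \<comment> \<open>\<open>None\<close> indexes the lower bound at \<open>z\<close> and
    \<open>Some x\<close> the upper bound at \<open>x\<close>; they stay distinct even if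
    \<open>z\<close> lies in \<open>Z\<close>.\<close>
  let ?I = "insert None (Some ` Z)"
  define f where "f T i = (case i of None \<Rightarrow> supp_fun S z - \<epsilon> - supp_fun T z
    | Some x \<Rightarrow> supp_fun T x - (supp_fun S x + \<epsilon>))" for T i
  have cone: "U + T \<in> K" "t \<ge> 0 \<Longrightarrow> dilate t T \<in> K" if "U \<in> K" "T \<in> K" for U T t
    using K(2) that by (auto simp: cone_of_figures_def)
  have "\<exists>\<mu>. (\<forall>i\<in>?I. \<mu> i \<ge> 0) \<and> (\<exists>i\<in>?I. \<mu> i > 0) \<and> (\<forall>T\<in>K. (\<Sum>i\<in>?I. \<mu> i * f T i) \<ge> 0)"
  proof (rule convexlike_alternative)
    show "\<exists>i\<in>?I. f T i \<ge> 0" if "T \<in> K" for T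
      using contra that by (force simp: f_def not_less)
    fix U T and t :: real
    assume UT: "U \<in> K" "T \<in> K" and t: "0 \<le> t" "t \<le> 1"
    have fig: "U \<in> convex_figures" "T \<in> convex_figures" using UT K(1) by auto
    have "supp_fun (dilate (1 - t) U + dilate t T) x = (1 - t) * supp_fun U x + t * supp_fun T x" for x
      using fig t by (simp add: supp_fun_plus supp_fun_dilate dilate_in_figures)
    then have "f (dilate (1 - t) U + dilate t T) i = (1 - t) * f U i + t * f T i" for i
      by (cases i) (simp_all add: f_def algebra_simps)
    moreover have "dilate (1 - t) U + dilate t T \<in> K" using cone UT t by simp
    ultimately show "\<exists>w\<in>K. \<forall>i\<in>?I. f w i \<le> (1 - t) * f U i + t * f T i" by (metis order_refl)
  qed (use Z in auto)
  then obtain \<mu> where \<mu>: "\<forall>i\<in>?I. \<mu> i \<ge> 0" "\<exists>i\<in>?I. \<mu> i > 0"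
    "\<And>T. T \<in> K \<Longrightarrow> (\<Sum>i\<in>?I. \<mu> i * f T i) \<ge> 0" by blast
  define \<kappa> where "\<kappa> = (\<Sum>i\<in>?I. \<mu> i)"
  have "\<kappa> > 0" unfolding \<kappa>_def using \<mu>(1,2) Z by (metis finite.insertI finite_imageI sum_pos2)
  \<comment> \<open>\<open>\<Phi>\<close> is the homogeneous part of the weighted sum; the remaining
    constant is \<open>- \<Phi> S - \<epsilon> * \<kappa>\<close>.\<close>
  define \<Phi> where "\<Phi> T = (\<Sum>x\<in>Z. \<mu> (Some x) * supp_fun T x) - \<mu> None * supp_fun T z" for T
  have sum_f: "(\<Sum>i\<in>?I. \<mu> i * f T i) = \<Phi> T - \<Phi> S - \<epsilon> * \<kappa>" for T
    using Z by (simp add: f_def \<Phi>_def \<kappa>_def sum.reindex comp_def algebra_simps sum.distrib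
        sum_subtractf sum_distrib_left)
  have \<Phi>_nonneg: "\<Phi> T \<ge> 0" if T: "T \<in> K" for T
  proof (rule ccontr)
    assume neg: "\<not> \<Phi> T \<ge> 0"
    \<comment> \<open>The factor is large enough to push \<open>\<Phi> (dilate t T)\<close> below
      \<open>\<Phi> S\<close>.\<close>
    define t where "t = (\<bar>\<Phi> S\<bar> + 1) / - \<Phi> T"
    have t: "t \<ge> 0" "t * \<Phi> T = - (\<bar>\<Phi> S\<bar> + 1)"
      using neg by (auto simp: t_def divide_nonneg_neg field_simps)
    have "T \<in> convex_figures" using T K(1) by blast
    then have "\<Phi> (dilate t T) = t * \<Phi> T"
      using t(1) by (simp add: \<Phi>_def supp_fun_dilate sum_distrib_left algebra_simps)
    moreover have "\<Phi> (dilate t T) - \<Phi> S - \<epsilon> * \<kappa> \<ge> 0"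
      using \<mu>(3)[of "dilate t T"] cone(2)[OF T T t(1)] sum_f by simp
    moreover have "\<epsilon> * \<kappa> > 0" using \<open>\<kappa> > 0\<close> \<epsilon> by simp
    ultimately show False using t(2) by linarith
  qed
  have "\<Phi> S < 0"
  proof -
    obtain T where T: "T \<in> K" using K(2) by (auto simp: cone_of_figures_def)
    then have "T \<in> convex_figures" using K(1) by blast
    then have "\<Phi> (dilate 0 T) = 0" by (simp add: \<Phi>_def supp_fun_dilate)
    moreover have "\<Phi> (dilate 0 T) - \<Phi> S - \<epsilon> * \<kappa> \<ge> 0"
      using \<mu>(3)[of "dilate 0 T"] cone(2)[OF T T] sum_f by simp
    moreover have "\<epsilon> * \<kappa> > 0" using \<open>\<kappa> > 0\<close> \<epsilon> by simp
    ultimately show ?thesis by linarith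
  qed
  \<comment> \<open>The weights are moved into the vectors, so that \<open>\<Phi> T \<ge> 0\<close>
    takes the form of an inequality in \<open>dominated\<close>.\<close>
  obtain zs where zs: "set zs = Z" "distinct zs" using finite_distinct_list[OF Z] by blast
  let ?xs = "map (\<lambda>x. \<mu> (Some x) *\<^sub>R x) zs"
  have "supp_fun T (\<mu> None *\<^sub>R z) = \<mu> None * supp_fun T z"
    "(\<Sum>x\<leftarrow>?xs. supp_fun T x) = (\<Sum>x\<in>Z. \<mu> (Some x) * supp_fun T x)"
    if "T \<in> convex_figures" for T
  proof -
    show "supp_fun T (\<mu> None *\<^sub>R z) = \<mu> None * supp_fun T z"
      using that \<mu>(1) by (simp add: supp_fun_scaleR)
    have "(\<Sum>x\<leftarrow>?xs. supp_fun T x) = (\<Sum>x\<in>Z. supp_fun T (\<mu> (Some x) *\<^sub>R x))"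
      using zs by (simp add: comp_def sum_list_distinct_conv_sum_set)
    also have "\<dots> = (\<Sum>x\<in>Z. \<mu> (Some x) * supp_fun T x)"
      using \<mu>(1) that by (intro sum.cong) (auto simp: supp_fun_scaleR)
    finally show "(\<Sum>x\<leftarrow>?xs. supp_fun T x) = (\<Sum>x\<in>Z. \<mu> (Some x) * supp_fun T x)" .
  qed
  then have \<Phi>_iff: "\<Phi> T \<ge> 0 \<longleftrightarrow> supp_fun T (\<mu> None *\<^sub>R z) \<le> (\<Sum>x\<leftarrow>?xs. supp_fun T x)"
    if "T \<in> convex_figures" for T
    using that by (simp add: \<Phi>_def)
  have "supp_fun S (\<mu> None *\<^sub>R z) \<le> (\<Sum>x\<leftarrow>?xs. supp_fun S x)"
  proof (rule dominatedD[OF S(2)])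
    fix \<xi> assume "\<xi> \<in> \<Xi>"
    then have "F \<xi> \<in> K" using K(3) by blast
    then show "supp_fun (F \<xi>) (\<mu> None *\<^sub>R z) \<le> (\<Sum>x\<leftarrow>?xs. supp_fun (F \<xi>) x)"
      using \<Phi>_nonneg \<Phi>_iff K(1) by blast
  qed
  then show False using \<open>\<Phi> S < 0\<close> \<Phi>_iff[OF S(1)] by simp
qed

text \<open>Upper bounds on \<open>Z\<close> survive a join, and a lower bound at a point survives
  as soon as one of the joined figures has it. Induction over the points collects the lower
  bounds.\<close>

lemma approximation_on_finite:
  assumes K: "K \<subseteq> convex_figures" "cone_of_figures K" "F ` \<Xi> \<subseteq> K"
      "\<And>S T. S \<in> K \<Longrightarrow> T \<in> K \<Longrightarrow> join {S, T} \<in> K"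
    and S: "S \<in> convex_figures" "dominated \<Xi> F S"
    and Z: "finite Z" and \<epsilon>: "\<epsilon> > 0"
  shows "\<exists>T\<in>K. \<forall>x\<in>Z. \<bar>supp_fun T x - supp_fun S x\<bar> < \<epsilon>"
proof -
  have "\<exists>T\<in>K. (\<forall>x\<in>Y. supp_fun T x > supp_fun S x - \<epsilon>) \<and> (\<forall>x\<in>Z. supp_fun T x < supp_fun S x + \<epsilon>)"
    if "finite Y" for Y
    using that
  proof induction
    case empty
    \<comment> \<open>Only the upper bounds are wanted here; the origin is an arbitrary choice of
      point.\<close>
    show ?case using approximation_at_point[OF K(1-3) S Z \<epsilon>, of 0] by blast
  next
    case (insert y Y)
    then obtain T where T: "T \<in> K" "\<forall>x\<in>Y. supp_fun T x > supp_fun S x - \<epsilon>"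
      "\<forall>x\<in>Z. supp_fun T x < supp_fun S x + \<epsilon>" by blast
    obtain U where U: "U \<in> K" "supp_fun U y > supp_fun S y - \<epsilon>"
      "\<forall>x\<in>Z. supp_fun U x < supp_fun S x + \<epsilon>"
      using approximation_at_point[OF K(1-3) S Z \<epsilon>, of y] by blast
    have "supp_fun (join {T, U}) x = max (supp_fun T x) (supp_fun U x)" for x
      using T(1) U(1) K(1) by (intro supp_fun_join) auto
    then show ?case
      using T U K(4)[OF T(1) U(1)] by (intro bexI[of _ "join {T, U}"]) (auto simp: less_max_iff_disj)
  qed
  from this[OF Z] obtain T where "T \<in> K"
    "\<forall>x\<in>Z. supp_fun T x > supp_fun S x - \<epsilon> \<and> supp_fun T x < supp_fun S x + \<epsilon>" by blast
  then show ?thesis by (intro bexI[of _ T]) (auto simp: abs_less_iff algebra_simps)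
qed

text \<open>Values at the coordinate vectors bound a gauge, hence the Lipschitz constant of its
  support function, so closeness on a fine finite net including them spreads to the sphere.\<close>

lemma supp_fun_finite_net:
  assumes S: "S \<in> gauges" and \<epsilon>: "\<epsilon> > 0"
  obtains Z \<eta> where "finite Z" "\<eta> > 0"
    "\<And>T x. T \<in> gauges \<Longrightarrow> (\<And>y. y \<in> Z \<Longrightarrow> \<bar>supp_fun T y - supp_fun S y\<bar> < \<eta>) \<Longrightarrow>
       x \<in> sphere 0 1 \<Longrightarrow> \<bar>supp_fun T x - supp_fun S x\<bar> < \<epsilon>"
proof -
  \<comment> \<open>The 1 in each summand is the tolerance allowed at a coordinate vector, so that
    \<open>L\<close> does not depend on \<open>T\<close>.\<close>
  define L where "L = (\<Sum>b\<in>Basis. \<bar>supp_fun S b\<bar> + 1)"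
  have "L > 0" unfolding L_def by (intro sum_pos) auto
  define \<delta> where "\<delta> = \<epsilon> / (4 * L)"
  have "\<delta> > 0" using \<open>L > 0\<close> \<epsilon> by (simp add: \<delta>_def)
  obtain N :: "(real^'a) set" where N: "finite N" "sphere 0 1 \<subseteq> (\<Union>y\<in>N. ball y \<delta>)"
    using compact_eq_totally_bounded[of "sphere (0::real^'a) 1"] \<open>\<delta> > 0\<close> by auto
  \<comment> \<open>The 1 secures the common bound \<open>L\<close>; \<open>\<epsilon> / 4\<close>
    is the error at the net point, to which two Lipschitz errors of at most
    \<open>\<epsilon> / 4\<close> are added.\<close>
  define \<eta> where "\<eta> = min 1 (\<epsilon> / 4)"
  have bound: "norm y \<le> L"
    if T: "T \<in> gauges" and close: "\<And>b. b \<in> Basis \<Longrightarrow> supp_fun T b \<le> \<bar>supp_fun S b\<bar> + 1" and y: "y \<in> T"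
    for T and y :: "real^'a"
  proof -
    note fig = gauge_convex_figure[OF T]
    have "norm y \<le> (\<Sum>b\<in>Basis. \<bar>y \<bullet> b\<bar>)" by (rule norm_le_l1)
    also have "\<dots> \<le> L"
      unfolding L_def
    proof (rule sum_mono)
      fix b :: "real^'a" assume b: "b \<in> Basis"
      have "y \<bullet> b \<le> supp_fun T b" "y \<bullet> (- b) \<le> supp_fun T (- b)"
        using y mem_iff_supp_fun[OF fig] by blast+
      then show "\<bar>y \<bullet> b\<bar> \<le> \<bar>supp_fun S b\<bar> + 1"
        using gauge_supp_fun_minus[OF T, of b] close[OF b] by simp
    qed
    finally show ?thesis .
  qed
  show ?thesis
  proof (rule that[of "N \<union> Basis" \<eta>])
    show "finite (N \<union> Basis)" "\<eta> > 0" using N \<epsilon> by (auto simp: \<eta>_def)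
    fix T x
    assume T: "T \<in> gauges" and x: "x \<in> sphere (0::real^'a) 1"
      and close: "\<And>y. y \<in> N \<union> Basis \<Longrightarrow> \<bar>supp_fun T y - supp_fun S y\<bar> < \<eta>"
    obtain y where y: "y \<in> N" "norm (x - y) < \<delta>"
      using N(2) x by (auto simp: dist_norm norm_minus_commute)
    have lip: "\<bar>supp_fun U x - supp_fun U y\<bar> \<le> \<epsilon> / 4"
      if "U \<in> gauges" "\<And>b. b \<in> Basis \<Longrightarrow> supp_fun U b \<le> \<bar>supp_fun S b\<bar> + 1" for U
    proof -
      have "\<bar>supp_fun U x - supp_fun U y\<bar> \<le> L * norm (x - y)"
        by (rule supp_fun_Lipschitz[OF gauge_convex_figure[OF that(1)] bound[OF that]])
      also have "\<dots> \<le> L * \<delta>" using y \<open>L > 0\<close> by (intro mult_left_mono) auto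
      also have "\<dots> = \<epsilon> / 4" using \<open>L > 0\<close> by (simp add: \<delta>_def)
      finally show ?thesis .
    qed
    have "supp_fun T b \<le> \<bar>supp_fun S b\<bar> + 1" if "b \<in> Basis" for b
    proof -
      have "\<bar>supp_fun T b - supp_fun S b\<bar> < \<eta>" "\<eta> \<le> 1" using close[of b] that by (auto simp: \<eta>_def)
      then show ?thesis by linarith
    qed
    then have "\<bar>supp_fun T x - supp_fun T y\<bar> \<le> \<epsilon> / 4" by (intro lip T)
    moreover have "\<bar>supp_fun S x - supp_fun S y\<bar> \<le> \<epsilon> / 4" by (intro lip S) linarith
    moreover have "\<bar>supp_fun T y - supp_fun S y\<bar> < \<epsilon> / 4" using close[of y] y by (simp add: \<eta>_def)
    ultimately show "\<bar>supp_fun T x - supp_fun S x\<bar> < \<epsilon>" using \<epsilon> by linarith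
  qed
qed

text \<open>Each class \<open>K\<close> in the intersection defining the hull is treated separately.
  Approximation on suitable finite sets is uniform on the sphere, so \<open>S\<close> is a limit of
  members of \<open>K\<close> and lies in \<open>K\<close> by closedness.\<close>

lemma dominated_imp_upper_hull:
  assumes S: "S \<in> gauges" "dominated \<Xi> F S"
  shows "S \<in> upper_hull \<Xi> F"
  unfolding upper_hull_def hull_def
proof (rule InterI, clarify)
  fix K assume sub: "F ` \<Xi> \<subseteq> K" and K: "K \<subseteq> gauges" "cone_of_figures K" "closed_figures K"
    "\<forall>S\<in>K. \<forall>T\<in>K. join {S, T} \<in> K"
  have fig: "K \<subseteq> convex_figures" using K(1) gauge_convex_figure by blast
  have "\<exists>T\<in>K. \<forall>x\<in>sphere 0 1. \<bar>supp_fun T x - supp_fun S x\<bar> < \<epsilon>" if \<epsilon>: "\<epsilon> > 0" for \<epsilon>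
  proof -
    obtain Z \<eta> where Z: "finite Z" "\<eta> > 0"
      "\<And>T x. T \<in> gauges \<Longrightarrow> (\<And>y. y \<in> Z \<Longrightarrow> \<bar>supp_fun T y - supp_fun S y\<bar> < \<eta>) \<Longrightarrow>
       x \<in> sphere 0 1 \<Longrightarrow> \<bar>supp_fun T x - supp_fun S x\<bar> < \<epsilon>"
      using supp_fun_finite_net[OF S(1) \<epsilon>] by blast
    obtain T where "T \<in> K" "\<forall>x\<in>Z. \<bar>supp_fun T x - supp_fun S x\<bar> < \<eta>"
      using approximation_on_finite[OF fig K(2) sub _ gauge_convex_figure[OF S(1)] S(2) Z(1,2)] K(4)
      by blast
    then show ?thesis using Z(3) K(1) by blast
  qed
  then have "\<forall>n. \<exists>T\<in>K. \<forall>x\<in>sphere 0 1. \<bar>supp_fun T x - supp_fun S x\<bar> < inverse (real (Suc n))"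
    by simp
  then obtain G where G: "\<And>n. G n \<in> K"
    "\<And>n x. x \<in> sphere 0 1 \<Longrightarrow> \<bar>supp_fun (G n) x - supp_fun S x\<bar> < inverse (real (Suc n))"
    by metis
  have "uniform_limit (sphere 0 1) (\<lambda>n. supp_fun (G n)) (supp_fun S) sequentially"
  proof (rule uniform_limitI)
    fix e :: real assume "e > 0"
    then have "eventually (\<lambda>n. inverse (real (Suc n)) < e) sequentially"
      using order_tendstoD(2)[OF LIMSEQ_inverse_real_of_nat] by blast
    then show "\<forall>\<^sub>F n in sequentially. \<forall>x\<in>sphere 0 1. dist (supp_fun (G n) x) (supp_fun S x) < e"
      by eventually_elim (use G(2) in \<open>simp add: dist_real_def del: of_nat_Suc, meson less_trans\<close>)
  qed
  then show "S \<in> K"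
    using K(3) G(1) gauge_convex_figure[OF S(1)] unfolding closed_figures_def by blast
qed

theorem corollary4p2:
  fixes F :: "'i \<Rightarrow> (real^'n) set" and \<Xi> :: "'i set" and S :: "(real^'n) set"
  assumes "nondegenerate \<Xi> F"
    and "S \<in> gauges" and "S \<noteq> {0}"
  shows "S \<in> upper_hull \<Xi> F \<longleftrightarrow>
    S = (\<Inter>xs\<in>{xs :: (real^'n) list. \<exists>x\<in>set xs. x \<noteq> 0}.
          dilate (\<Sum>x\<leftarrow>xs. supp_fun S x)
            (join ((\<lambda>\<xi>. dilate (1 / (\<Sum>x\<leftarrow>xs. supp_fun (F \<xi>) x)) (F \<xi>)) ` \<Xi>)))"
proof -
  have "S \<in> upper_hull \<Xi> F \<longleftrightarrow> dominated \<Xi> F S"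
    using upper_hull_imp_dominated[OF assms(1)] dominated_imp_upper_hull[OF assms(2)] by blast
  also have "\<dots> \<longleftrightarrow> S = (\<Inter>xs\<in>{xs. \<exists>x\<in>set xs. x \<noteq> 0}.
          dilate (\<Sum>x\<leftarrow>xs. supp_fun S x)
            (join ((\<lambda>\<xi>. dilate (1 / (\<Sum>x\<leftarrow>xs. supp_fun (F \<xi>) x)) (F \<xi>)) ` \<Xi>)))"
    using assms by (intro dominated_iff_meet) (auto simp: nondegenerate_def gauges_def)
  finally show ?thesis .
qed

end
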